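(* Let $\mathcal{H}$ be a Hilbert space, let $f,g:\mathcal{H}\to(-\infty,\infty]$ be closed, proper, and convex, let $\gamma>0$ and $\lambda\in(0,1]$. Let $z\in\mathcal{H}$, let $z^+:=(T_{\mathrm{PRS}})_\lambda(z)$, and let $x_g:=\mathbf{prox}_{\gamma g}(z)$ and $x_f:=\mathbf{prox}_{\gamma f}(\mathbf{refl}_{\gamma g}(z))$. Then for all $x\in\operatorname{dom}(f)\cap\operatorname{dom}(g)$, $$4\gamma\lambda\left(f(x_f)+g(x_g)-f(x)-g(x)\right)\le\|z-x\|^2-\|z^+-x\|^2+\left(1-\frac1\lambda\right)\|z^+-z\|^2.$$
   Context: $\mathbf{prox}_{\gamma f}(x):=\arg\min_{y\in\mathcal{H}}f(y)+\frac{1}{2\gamma}\|y-x\|^2$, $\mathbf{refl}_{\gamma f}:=2\mathbf{prox}_{\gamma f}-I_{\mathcal{H}}$, $T_{\mathrm{PRS}}:=\mathbf{refl}_{\gamma f}\circ\mathbf{refl}_{\gamma g}$, $(T_{\mathrm{PRS}})_\lambda:=(1-\lambda)I_{\mathcal{H}}+\lambda T_{\mathrm{PRS}}$. *)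

theory Defs
  imports "HOL-Analysis.Analysis"
begin

definition eff_dom :: "('a \<Rightarrow> ereal) \<Rightarrow> 'a set" where
  "eff_dom f = {x. f x < \<infinity>}"

definition ext_epigraph :: "('a \<Rightarrow> ereal) \<Rightarrow> ('a \<times> real) set" where
  "ext_epigraph f = {(x, r). f x \<le> ereal r}"

text \<open>The first conjunct of \<open>proper_fun\<close> restricts the codomain to
  \<open>(-\<infinity>, \<infinity>]\<close>. Closedness (lower semicontinuity) and convexity are those of the
  epigraph in the product of the space with the reals.\<close>

definition proper_fun :: "('a \<Rightarrow> ereal) \<Rightarrow> bool" where
  "proper_fun f \<longleftrightarrow> (\<forall>x. f x \<noteq> -\<infinity>) \<and> eff_dom f \<noteq> {}"

definition closed_fun :: "('a::topological_space \<Rightarrow> ereal) \<Rightarrow> bool" where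
  "closed_fun f \<longleftrightarrow> closed (ext_epigraph f)"

definition convex_fun :: "('a::real_vector \<Rightarrow> ereal) \<Rightarrow> bool" where
  "convex_fun f \<longleftrightarrow> convex (ext_epigraph f)"

text \<open>\<open>arg_min_on\<close> chooses some minimizer; for closed, proper, convex \<open>f\<close> on a Hilbert
  space and \<open>\<gamma> > 0\<close> the minimizer exists and is unique.\<close>

definition prox :: "real \<Rightarrow> ('a::real_inner \<Rightarrow> ereal) \<Rightarrow> 'a \<Rightarrow> 'a" where
  "prox \<gamma> f x = arg_min_on (\<lambda>y. f y + ereal (1 / (2 * \<gamma>) * (norm (y - x))\<^sup>2)) UNIV"

definition refl_op :: "real \<Rightarrow> ('a::real_inner \<Rightarrow> ereal) \<Rightarrow> 'a \<Rightarrow> 'a" where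
  "refl_op \<gamma> f x = 2 *\<^sub>R prox \<gamma> f x - x"

definition T_PRS ::
    "real \<Rightarrow> ('a::real_inner \<Rightarrow> ereal) \<Rightarrow> ('a \<Rightarrow> ereal) \<Rightarrow> 'a \<Rightarrow> 'a" where
  "T_PRS \<gamma> f g = refl_op \<gamma> f \<circ> refl_op \<gamma> g"

definition relaxed :: "real \<Rightarrow> ('a::real_vector \<Rightarrow> 'a) \<Rightarrow> 'a \<Rightarrow> 'a" where
  "relaxed l T x = (1 - l) *\<^sub>R x + l *\<^sub>R T x"

end

theory Submission
  imports Defs
begin

text \<open>
  The proximal point \<open>p\<close> of \<open>f\<close> at \<open>x\<close> satisfies
  \<open>f p + \<langle>x - p, u - p\<rangle> / \<gamma> \<le> f u\<close> for every \<open>u\<close>. Adding the two instances for \<open>g\<close> at \<open>z\<close>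
  and for \<open>f\<close> at the reflected point, both tested at \<open>x\<close>, gives the claim: since
  \<open>zp = z + 2 l (xf - xg)\<close>, the right-hand side of the theorem is exactly
  \<open>- 4 l (\<langle>xf - xg, z - x\<rangle> + \<parallel>xf - xg\<parallel>\<^sup>2)\<close>. Existence of the proximal point comes from a
  minimizing sequence, which is Cauchy by the parallelogram law.
\<close>

section \<open>Epigraphs, convexity along segments, and a linear lower bound\<close>

lemma ext_epigraph_iff [simp]: "(x, r) \<in> ext_epigraph f \<longleftrightarrow> f x \<le> ereal r"
  by (simp add: ext_epigraph_def)

text \<open>Real upper bounds \<open>r\<close> and \<open>s\<close> stand in for the function
  values, so that the interpolation takes place in the reals and applies to any points of the
  epigraph.\<close>

lemma convex_fun_segment:
  assumes "convex_fun f" "f x \<le> ereal r" "f y \<le> ereal s" "0 \<le> t" "t \<le> 1"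
  shows "f (x + t *\<^sub>R (y - x)) \<le> ereal (r + t * (s - r))"
proof -
  have "(1 - t) *\<^sub>R (x, r) + t *\<^sub>R (y, s) \<in> ext_epigraph f"
    using assms by (intro convexD_alt) (auto simp: convex_fun_def)
  moreover have "(1 - t) *\<^sub>R (x, r) + t *\<^sub>R (y, s) = (x + t *\<^sub>R (y - x), r + t * (s - r))"
    by (simp add: algebra_simps)
  ultimately show ?thesis by (metis ext_epigraph_iff)
qed

text \<open>A direct substitute for an affine minorant: on a small ball around \<open>x0\<close> the function
  exceeds \<open>a - 1\<close>, and convexity along rays from \<open>x0\<close> spreads this to the whole space.\<close>

lemma closed_convex_linear_lower_bound:
  fixes f :: "'a::real_normed_vector \<Rightarrow> ereal"
  assumes "closed_fun f" "convex_fun f" and a: "f x0 = ereal a"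
  obtains K where "K \<ge> 0" "\<And>y s. f y \<le> ereal s \<Longrightarrow> a - 1 - K * norm (y - x0) \<le> s"
proof -
  have "open (- ext_epigraph f)" "(x0, a - 1) \<in> - ext_epigraph f"
    using assms by (auto simp: closed_fun_def)
  then obtain e where e: "e > 0" "ball (x0, a - 1) e \<subseteq> - ext_epigraph f"
    by (meson open_contains_ball)
  have near: "a - 1 < s" if "f y \<le> ereal s" "norm (y - x0) < e" for y s
  proof (rule ccontr)
    assume "\<not> a - 1 < s"
    \<comment> \<open>The epigraph is closed upwards, so a height \<open>s\<close> below
      \<open>a - 1\<close> would put \<open>(y, a - 1)\<close> into it, although the ball misses
      it.\<close>
    then have "f y \<le> ereal (a - 1)" using that by (meson ereal_less_eq(3) not_less order_trans)
    moreover have "(y, a - 1) \<in> ball (x0, a - 1) e"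
      using that by (simp add: dist_Pair_Pair dist_norm norm_minus_commute)
    ultimately show False using e by fastforce
  qed
  show ?thesis
  proof
    show "2 / e \<ge> 0" using e by simp
    fix y s assume ys: "f y \<le> ereal s"
    define r where "r = norm (y - x0)"
    show "a - 1 - 2 / e * norm (y - x0) \<le> s"
    proof (cases "r < e")
      case True
      have "0 \<le> 2 / e * r" using e by (simp add: r_def)
      then show ?thesis using near[OF ys] True by (simp add: r_def)
    next
      case False
      \<comment> \<open>This \<open>t\<close> pulls \<open>y\<close> back along the ray to distance
        \<open>e / 2\<close> from \<open>x0\<close>, where \<open>near\<close> applies. There
        \<open>a - 1 < a + t * (s - a)\<close>, hence \<open>s > a - 1 / t\<close>, and
        \<open>1 / t = 2 / e * r\<close> explains the slope \<open>2 / e\<close>.\<close>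
      define t where "t = e / (2 * r)"
      have r: "r > 0" using False e by simp
      have t: "t > 0" "t \<le> 1" using r e False by (auto simp: t_def)
      have "f (x0 + t *\<^sub>R (y - x0)) \<le> ereal (a + t * (s - a))"
        using convex_fun_segment[OF assms(2) _ ys] a t by simp
      moreover have "norm (x0 + t *\<^sub>R (y - x0) - x0) < e"
      proof -
        have "norm (x0 + t *\<^sub>R (y - x0) - x0) = t * r" using t by (simp add: r_def)
        also have "\<dots> = e / 2" using r by (simp add: t_def)
        finally show ?thesis using e by simp
      qed
      ultimately have "a - 1 < a + t * (s - a)" by (rule near)
      then have "- 1 / t < s - a" using t by (simp add: field_simps)
      moreover have "1 / t = 2 / e * r" by (simp add: t_def)
      ultimately show ?thesis by (simp add: r_def)
    qed
  qed
qed

section \<open>Existence of the proximal point\<close>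

lemma parallelogram_midpoint:
  fixes u v x :: "'a::real_inner"
  shows "(norm (u + (1/2) *\<^sub>R (v - u) - x))\<^sup>2
    = (norm (u - x))\<^sup>2 / 2 + (norm (v - x))\<^sup>2 / 2 - (norm (u - v))\<^sup>2 / 4"
  unfolding power2_norm_eq_inner
  by (simp add: inner_simps inner_commute field_simps)

lemma prox_objective_attains:
  fixes f :: "'a::{real_inner, complete_space} \<Rightarrow> ereal"
  assumes cl: "closed_fun f" and pr: "proper_fun f" and cv: "convex_fun f" and c: "c > 0"
  obtains p where "\<And>y. f p + ereal (c * (norm (p - x))\<^sup>2) \<le> f y + ereal (c * (norm (y - x))\<^sup>2)"
proof -
  obtain x0 where x0: "f x0 < \<infinity>" "f x0 \<noteq> -\<infinity>" using pr by (auto simp: proper_fun_def eff_dom_def)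
  then obtain a where a: "f x0 = ereal a" by (cases "f x0") auto
  obtain K where K: "K \<ge> 0" "\<And>y s. f y \<le> ereal s \<Longrightarrow> a - 1 - K * norm (y - x0) \<le> s"
    using closed_convex_linear_lower_bound[OF cl cv a] by blast
  \<comment> \<open>Using real heights \<open>s\<close> above \<open>f y\<close> makes the infimum a
    real one, and the minimizing sequence becomes a sequence of epigraph points, to which closedness
    applies directly.\<close>
  define V where "V = {s + c * (norm (y - x))\<^sup>2 |y s. f y \<le> ereal s}"
  define m where "m = Inf V"
  have "a + c * (norm (x0 - x))\<^sup>2 \<in> V"
    unfolding V_def using a by (metis (mono_tags, lifting) mem_Collect_eq order_refl)
  then have V0: "V \<noteq> {}" by blast
  have bdd: "bdd_below V"
  proof (rule bdd_belowI)
    fix v assume "v \<in> V"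
    then obtain y s where ys: "f y \<le> ereal s" "v = s + c * (norm (y - x))\<^sup>2" by (auto simp: V_def)
    define r where "r = norm (y - x)"
    have "norm (y - x0) \<le> r + norm (x - x0)"
      unfolding r_def using norm_triangle_ineq[of "y - x" "x - x0"] by simp
    then have "K * norm (y - x0) \<le> K * r + K * norm (x - x0)"
      using K(1) by (metis distrib_left mult_left_mono)
    \<comment> \<open>Completing the square: the quadratic term absorbs the linear decrease that the
      lower bound still allows.\<close>
    moreover have "K * r \<le> c * r\<^sup>2 + K\<^sup>2 / (4 * c)"
    proof -
      have "0 \<le> (2 * c * r - K)\<^sup>2 / (4 * c)" using c by simp
      also have "\<dots> = c * r\<^sup>2 + K\<^sup>2 / (4 * c) - K * r"
        using c by (simp add: field_simps power2_eq_square)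
      finally show ?thesis by simp
    qed
    ultimately show "a - 1 - K * norm (x - x0) - K\<^sup>2 / (4 * c) \<le> v"
      using K(2)[OF ys(1)] ys(2) unfolding r_def by linarith
  qed
  have m_le: "m \<le> s + c * (norm (y - x))\<^sup>2" if "f y \<le> ereal s" for y s
    unfolding m_def using that by (intro cInf_lower[OF _ bdd]) (auto simp: V_def)
  have "\<exists>y s. f y \<le> ereal s \<and> s + c * (norm (y - x))\<^sup>2 < m + 1 / real (Suc n)" for n
  proof -
    have "m < m + 1 / real (Suc n)" by simp
    then obtain v where "v \<in> V" "v < m + 1 / real (Suc n)"
      unfolding m_def using cInf_lessD[OF V0] by blast
    then show ?thesis by (auto simp: V_def)
  qed
  then obtain Y S where YS: "\<And>n. f (Y n) \<le> ereal (S n)"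
      "\<And>n. S n + c * (norm (Y n - x))\<^sup>2 < m + 1 / real (Suc n)"
    by metis
  \<comment> \<open>At the midpoint the objective is at least \<open>m\<close>, yet at most the
    average of two values below \<open>m + 1 / real (Suc N)\<close>, less \<open>c / 4\<close> times
    the squared distance.\<close>
  have dist2: "c / 4 * (norm (Y i - Y j))\<^sup>2 \<le> 1 / real (Suc N)" if "i \<ge> N" "j \<ge> N" for i j N
  proof -
    have mid: "f (Y i + (1/2) *\<^sub>R (Y j - Y i)) \<le> ereal (S i + (1/2) * (S j - S i))"
      by (intro convex_fun_segment cv YS) auto
    have "c * (norm (Y i + (1/2) *\<^sub>R (Y j - Y i) - x))\<^sup>2
      = c * (norm (Y i - x))\<^sup>2 / 2 + c * (norm (Y j - x))\<^sup>2 / 2 - c / 4 * (norm (Y i - Y j))\<^sup>2"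
      unfolding parallelogram_midpoint by (simp add: algebra_simps)
    moreover have "1 / real (Suc i) \<le> 1 / real (Suc N)" "1 / real (Suc j) \<le> 1 / real (Suc N)"
      using that by (auto intro!: divide_left_mono)
    ultimately show ?thesis
      using m_le[OF mid] YS(2)[of i] YS(2)[of j] by argo
  qed
  have "Cauchy Y"
  proof (rule metric_CauchyI)
    fix e :: real assume e: "e > 0"
    then have "c / 4 * e\<^sup>2 > 0" using c by simp
    then obtain N where N: "1 / real (Suc N) < c / 4 * e\<^sup>2"
      by (metis nat_approx_posE)
    have "dist (Y i) (Y j) < e" if "i \<ge> N" "j \<ge> N" for i j
    proof -
      have "c / 4 * (norm (Y i - Y j))\<^sup>2 < c / 4 * e\<^sup>2"
        using dist2[OF that] N by linarith
      then have "(norm (Y i - Y j))\<^sup>2 < e\<^sup>2" using c by simp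
      then show ?thesis using e by (metis dist_norm less_eq_real_def power_less_imp_less_base)
    qed
    then show "\<exists>M. \<forall>m\<ge>M. \<forall>n\<ge>M. dist (Y m) (Y n) < e" by blast
  qed
  then obtain p where p: "Y \<longlonglongrightarrow> p" by (meson Cauchy_convergent convergent_def)
  \<comment> \<open>Squeezing gives a limit only for the sum; subtracting the convergent quadratic
    term then yields the limit of the heights \<open>S n\<close>.\<close>
  have "(\<lambda>n. S n + c * (norm (Y n - x))\<^sup>2) \<longlonglongrightarrow> m"
  proof (rule tendsto_sandwich)
    show "\<forall>\<^sub>F n in sequentially. m \<le> S n + c * (norm (Y n - x))\<^sup>2" using m_le YS by simp
    show "\<forall>\<^sub>F n in sequentially. S n + c * (norm (Y n - x))\<^sup>2 \<le> m + 1 / real (Suc n)"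
      using YS(2) by (simp add: less_imp_le)
    show "(\<lambda>n. m + 1 / real (Suc n)) \<longlonglongrightarrow> m"
      using tendsto_add[OF tendsto_const LIMSEQ_inverse_real_of_nat, of m]
      by (simp add: inverse_eq_divide)
  qed simp
  then have "(\<lambda>n. (S n + c * (norm (Y n - x))\<^sup>2) - c * (norm (Y n - x))\<^sup>2)
      \<longlonglongrightarrow> m - c * (norm (p - x))\<^sup>2"
    by (intro tendsto_intros p)
  then have "(\<lambda>n. (Y n, S n)) \<longlonglongrightarrow> (p, m - c * (norm (p - x))\<^sup>2)"
    by (intro tendsto_Pair p) simp
  then have "(p, m - c * (norm (p - x))\<^sup>2) \<in> ext_epigraph f"
    by (rule closed_sequentially[rotated 2]) (use cl YS(1) in \<open>auto simp: closed_fun_def\<close>)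
  then have fp: "f p \<le> ereal (m - c * (norm (p - x))\<^sup>2)" by simp
  show ?thesis
  proof
    fix y
    have "f p + ereal (c * (norm (p - x))\<^sup>2) \<le> ereal m"
      using add_right_mono[OF fp, of "ereal (c * (norm (p - x))\<^sup>2)"] by simp
    also have "\<dots> \<le> f y + ereal (c * (norm (y - x))\<^sup>2)"
      using m_le[of y] pr by (cases "f y") (auto simp: proper_fun_def)
    finally show "f p + ereal (c * (norm (p - x))\<^sup>2) \<le> f y + ereal (c * (norm (y - x))\<^sup>2)" .
  qed
qed

section \<open>Minimality, finiteness and the variational inequality of the proximal point\<close>

lemma prox_minimizes:
  fixes f :: "'a::{real_inner, complete_space} \<Rightarrow> ereal"
  assumes "closed_fun f" "proper_fun f" "convex_fun f" "\<gamma> > 0"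
  shows "f (prox \<gamma> f x) + ereal (1 / (2 * \<gamma>) * (norm (prox \<gamma> f x - x))\<^sup>2)
    \<le> f y + ereal (1 / (2 * \<gamma>) * (norm (y - x))\<^sup>2)"
proof -
  let ?h = "\<lambda>y. f y + ereal (1 / (2 * \<gamma>) * (norm (y - x))\<^sup>2)"
  obtain p where "\<And>y. ?h p \<le> ?h y"
    using prox_objective_attains[OF assms(1-3), of "1 / (2 * \<gamma>)" x] assms(4) by auto
  then have "is_arg_min ?h (\<lambda>x. x \<in> UNIV) p" by (auto simp: is_arg_min_def not_less)
  \<comment> \<open>\<open>arg_min_on\<close> is a Hilbert choice, so the existence of one minimizer
    makes the chosen point a minimizer.\<close>
  then have "is_arg_min ?h (\<lambda>x. x \<in> UNIV) (prox \<gamma> f x)"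
    unfolding prox_def arg_min_on_def arg_min_def by (rule someI)
  then show ?thesis by (auto simp: is_arg_min_def not_less)
qed

lemma prox_finite:
  fixes f :: "'a::{real_inner, complete_space} \<Rightarrow> ereal"
  assumes "closed_fun f" "proper_fun f" "convex_fun f" "\<gamma> > 0"
  obtains r where "f (prox \<gamma> f x) = ereal r"
proof -
  obtain u where "f u < \<infinity>" using assms(2) by (auto simp: proper_fun_def eff_dom_def)
  then have "f (prox \<gamma> f x) \<noteq> \<infinity>" using prox_minimizes[OF assms, of x u] by auto
  moreover have "f (prox \<gamma> f x) \<noteq> -\<infinity>" using assms(2) by (simp add: proper_fun_def)
  ultimately show ?thesis using that by (cases "f (prox \<gamma> f x)") auto
qed

text \<open>First-order optimality: compare the minimizer with points on the segment towards
  \<open>u\<close>, divide by the step length \<open>t\<close>, and let \<open>t\<close> tend to 0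
  from the right.\<close>

lemma prox_variational_inequality:
  fixes f :: "'a::{real_inner, complete_space} \<Rightarrow> ereal"
  assumes "closed_fun f" "proper_fun f" "convex_fun f" "\<gamma> > 0"
    and p: "f (prox \<gamma> f x) = ereal r" and u: "f u = ereal s"
  shows "\<gamma> * (r - s) \<le> (x - prox \<gamma> f x) \<bullet> (prox \<gamma> f x - u)"
proof -
  define q where "q = prox \<gamma> f x"
  \<comment> \<open>Twice the gap in the claim; convexity bounds it by a term of order
    \<open>t\<close>, so it is nonpositive in the limit.\<close>
  define A where "A = 2 * (\<gamma> * (r - s) - (x - q) \<bullet> (q - u))"
  have bound: "A \<le> t * (norm (u - q))\<^sup>2" if t: "0 < t" "t \<le> 1" for t
  proof -
    define y where "y = q + t *\<^sub>R (u - q)"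
    have fy: "f y \<le> ereal (r + t * (s - r))"
      unfolding y_def using t p u by (intro convex_fun_segment assms(3)) (auto simp: q_def)
    have "ereal r + ereal (1 / (2 * \<gamma>) * (norm (q - x))\<^sup>2)
        \<le> ereal (r + t * (s - r)) + ereal (1 / (2 * \<gamma>) * (norm (y - x))\<^sup>2)"
      using order_trans[OF prox_minimizes[OF assms(1-4), of x y] add_right_mono[OF fy]] p
      by (simp add: q_def)
    then have "t * (r - s) \<le> 1 / (2 * \<gamma>) * ((norm (y - x))\<^sup>2 - (norm (q - x))\<^sup>2)"
      by (simp add: algebra_simps)
    then have "2 * \<gamma> * (t * (r - s)) \<le> (norm (y - x))\<^sup>2 - (norm (q - x))\<^sup>2"
      using assms(4) by (simp add: field_simps)
    also have "\<dots> = t * (2 * ((x - q) \<bullet> (q - u)) + t * (norm (u - q))\<^sup>2)"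
      unfolding y_def power2_norm_eq_inner
      by (simp add: inner_simps inner_commute algebra_simps)
    finally have "t * A \<le> t * (t * (norm (u - q))\<^sup>2)"
      unfolding A_def by (simp add: algebra_simps)
    then show ?thesis using t by simp
  qed
  have "((\<lambda>t. t * (norm (u - q))\<^sup>2) \<longlongrightarrow> 0 * (norm (u - q))\<^sup>2) (at_right 0)"
    by (intro tendsto_intros)
  moreover have "\<forall>\<^sub>F t in at_right 0. A \<le> t * (norm (u - q))\<^sup>2"
    using bound by (auto simp: eventually_at_right_field intro!: exI[of _ 1])
  ultimately have "A \<le> 0 * (norm (u - q))\<^sup>2"
    by (rule tendsto_lowerbound) simp
  then show ?thesis by (simp add: A_def q_def)
qed

section \<open>The relaxed Peaceman-Rachford step\<close>

lemma relaxed_T_PRS_step: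
  assumes "xg = prox \<gamma> g z" "xf = prox \<gamma> f (refl_op \<gamma> g z)"
  shows "relaxed l (T_PRS \<gamma> f g) z = z + (2 * l) *\<^sub>R (xf - xg)"
proof -
  have "T_PRS \<gamma> f g z = z + 2 *\<^sub>R (xf - xg)"
    using assms by (simp add: T_PRS_def refl_op_def scaleR_diff_right)
  then show ?thesis by (simp add: relaxed_def scaleR_add_right scaleR_left_diff_distrib mult.commute)
qed

text \<open>The weight \<open>1 - 1 / l\<close> is the one that cancels the term quadratic in
  \<open>l\<close>: \<open>norm (zp - z)\<close> squared is
  \<open>4 * l * l * (d \<bullet> d)\<close> with \<open>d = xf - xg\<close>, and the same term
  occurs with a minus sign in the first difference. What remains is linear in
  \<open>l\<close>.\<close>

lemma relaxed_PRS_inner_identity: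
  fixes x z xf xg :: "'a::real_inner"
  assumes "l \<noteq> 0" and zp: "zp = z + (2 * l) *\<^sub>R (xf - xg)"
  shows "(norm (z - x))\<^sup>2 - (norm (zp - x))\<^sup>2 + (1 - 1 / l) * (norm (zp - z))\<^sup>2
    = 4 * l * ((z - xg) \<bullet> (xg - x) + (2 *\<^sub>R xg - z - xf) \<bullet> (xf - x))"
proof -
  define d where "d = xf - xg"
  have xf: "xf = xg + d" by (simp add: d_def)
  have "(1 - 1 / l) * (norm (zp - z))\<^sup>2 = 4 * l * (l - 1) * (d \<bullet> d)"
    using assms(1) by (simp add: zp d_def power_mult_distrib power2_norm_eq_inner)
      (simp add: field_simps power2_eq_square)
  then show ?thesis
    unfolding zp power2_norm_eq_inner xf
    by (simp add: inner_simps inner_commute algebra_simps)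
qed

theorem proposition4:
  fixes f g :: "'a::{real_inner, complete_space} \<Rightarrow> ereal"
    and \<gamma> l :: real
    and z zp xg xf :: 'a
  assumes "closed_fun f" and "proper_fun f" and "convex_fun f"
    and "closed_fun g" and "proper_fun g" and "convex_fun g"
    and "\<gamma> > 0" and "0 < l" and "l \<le> 1"
    and "zp = relaxed l (T_PRS \<gamma> f g) z"
    and "xg = prox \<gamma> g z"
    and "xf = prox \<gamma> f (refl_op \<gamma> g z)"
  shows "\<forall>x \<in> eff_dom f \<inter> eff_dom g.
    ereal (4 * \<gamma> * l) * (f xf + g xg - f x - g x)
      \<le> ereal ((norm (z - x))\<^sup>2 - (norm (zp - x))\<^sup>2 + (1 - 1 / l) * (norm (zp - z))\<^sup>2)"
proof
  fix x assume x: "x \<in> eff_dom f \<inter> eff_dom g"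
  \<comment> \<open>All four function values are finite, by the effective domains and properness at
    \<open>x\<close> and by minimality at \<open>xf\<close> and \<open>xg\<close>, so the claim
    reduces to a real inequality.\<close>
  obtain F where F: "f x = ereal F" using x assms(2)
    by (cases "f x") (auto simp: eff_dom_def proper_fun_def)
  obtain G where G: "g x = ereal G" using x assms(5)
    by (cases "g x") (auto simp: eff_dom_def proper_fun_def)
  obtain F' where F': "f xf = ereal F'" using prox_finite[OF assms(1-3,7)] assms(12) by metis
  obtain G' where G': "g xg = ereal G'" using prox_finite[OF assms(4-7)] assms(11) by metis
  have "\<gamma> * (G' - G) \<le> (z - xg) \<bullet> (xg - x)"
    using prox_variational_inequality[OF assms(4-7) _ G, of z] G' assms(11) by simp
  moreover have "\<gamma> * (F' - F) \<le> (2 *\<^sub>R xg - z - xf) \<bullet> (xf - x)"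
    using prox_variational_inequality[OF assms(1-3,7) _ F, of "refl_op \<gamma> g z"] F' assms(11,12)
    by (simp add: refl_op_def)
  ultimately have "\<gamma> * (F' + G' - F - G)
      \<le> (z - xg) \<bullet> (xg - x) + (2 *\<^sub>R xg - z - xf) \<bullet> (xf - x)"
    by (simp add: algebra_simps)
  then have "4 * l * (\<gamma> * (F' + G' - F - G))
      \<le> 4 * l * ((z - xg) \<bullet> (xg - x) + (2 *\<^sub>R xg - z - xf) \<bullet> (xf - x))"
    using assms(8) by (intro mult_left_mono) auto
  also have "\<dots> = (norm (z - x))\<^sup>2 - (norm (zp - x))\<^sup>2 + (1 - 1 / l) * (norm (zp - z))\<^sup>2"
    using assms(8,10) relaxed_T_PRS_step[OF assms(11,12)]
    by (intro relaxed_PRS_inner_identity[symmetric]) auto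
  finally show "ereal (4 * \<gamma> * l) * (f xf + g xg - f x - g x)
      \<le> ereal ((norm (z - x))\<^sup>2 - (norm (zp - x))\<^sup>2 + (1 - 1 / l) * (norm (zp - z))\<^sup>2)"
    by (simp add: F G F' G' mult_ac)
qed

end
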